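(* Let $F$ be the finite field of order $q$ and let $k,m,n$ be integers with $0\le k\le m\le n$. Then, as polynomials in $\mathbb{Z}[T]$, $$g_{m\times n,k}(T)=(T;q)_k\;A_{(m-k)\times(n-k)}(q^kT).$$
   Context: For $\alpha\in F$, $f^{\alpha}_{m\times n,r,k}$ is the number of $m\times n$ matrices $X$ over $F$ of rank $r$ with $X_{11}+\dots+X_{kk}=\alpha$ (for $k=0$ the empty sum is $0$). Put $g_{m\times n,r,k}=f^0_{m\times n,r,k}-f^1_{m\times n,r,k}$ and $g_{m\times n,k}(T)=\sum_{r=0}^{m}g_{m\times n,r,k}T^r$. Let $a(m\times n,r,q)$ be the number of $m\times n$ matrices of rank $r$ over $F$ and $A_{m\times n}(T)=\sum_{r=0}^{m}a(m\times n,r,q)T^r$. By convention there is exactly one matrix with zero rows or zero columns, and it has rank $0$. The $q$-Pochhammer symbol is $(T;q)_k=\prod_{i=0}^{k-1}(1-Tq^{i})$, with $(T;q)_0=1$. *)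

theory Defs
  imports
    "Jordan_Normal_Form.DL_Rank"
    "HOL-Computational_Algebra.Polynomial"
    "HOL-Library.Cardinality"
begin

text \<open>
  The finite field is the type \<^typ>\<open>'a::{field,finite}\<close> with \<open>CARD('a)\<close> elements. Matrices with
  entries in it are elements of \<open>carrier_mat m n\<close>, which allows zero dimensions; row and column
  indices start at \<open>0\<close>. The parameter of \<open>vec_space.rank\<close> is the number of rows: the rank is the
  dimension of the span of the columns.
\<close>

definition rank_mats :: "nat \<Rightarrow> nat \<Rightarrow> nat \<Rightarrow> 'a::{field,finite} mat set" where
  "rank_mats m n r = {X \<in> carrier_mat m n. vec_space.rank m X = r}"

definition f_count :: "nat \<Rightarrow> nat \<Rightarrow> nat \<Rightarrow> nat \<Rightarrow> 'a::{field,finite} \<Rightarrow> nat" where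
  "f_count m n r k \<alpha> = card {X \<in> rank_mats m n r. (\<Sum>i<k. X $$ (i, i)) = \<alpha>}"

definition g_coeff :: "'a::{field,finite} itself \<Rightarrow> nat \<Rightarrow> nat \<Rightarrow> nat \<Rightarrow> nat \<Rightarrow> int" where
  "g_coeff _ m n r k = int (f_count m n r k (0::'a)) - int (f_count m n r k (1::'a))"

definition g_poly :: "'a::{field,finite} itself \<Rightarrow> nat \<Rightarrow> nat \<Rightarrow> nat \<Rightarrow> int poly" where
  "g_poly F m n k = (\<Sum>r=0..m. monom (g_coeff F m n r k) r)"

definition a_count :: "'a::{field,finite} itself \<Rightarrow> nat \<Rightarrow> nat \<Rightarrow> nat \<Rightarrow> nat" where
  "a_count _ m n r = card (rank_mats m n r :: 'a mat set)"

definition A_poly :: "'a::{field,finite} itself \<Rightarrow> nat \<Rightarrow> nat \<Rightarrow> int poly" where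
  "A_poly F m n = (\<Sum>r=0..m. monom (int (a_count F m n r)) r)"

definition q_pochhammer :: "'r::comm_ring_1 \<Rightarrow> 'r \<Rightarrow> nat \<Rightarrow> 'r" where
  "q_pochhammer t q k = (\<Prod>i<k. 1 - t * q ^ i)"

text \<open>
  The sets counted above are finite, so \<^const>\<open>card\<close> is never the default value \<open>0\<close> of an infinite
  set; and there is exactly one matrix with zero rows or zero columns, of rank \<open>0\<close>.
\<close>

lemma finite_carrier_mat: "finite (carrier_mat m n :: 'a::finite mat set)"
proof -
  let ?D = "{..<m} \<times> {..<n}"
  have "carrier_mat m n \<subseteq> mat m n ` (?D \<rightarrow>\<^sub>E (UNIV :: 'a set))"
  proof
    fix X :: "'a mat" assume X: "X \<in> carrier_mat m n"
    have "X = mat m n (restrict (($$) X) ?D)"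
      by (rule eq_matI) (use X in simp_all)
    moreover have "restrict (($$) X) ?D \<in> ?D \<rightarrow>\<^sub>E UNIV"
      by simp
    ultimately show "X \<in> mat m n ` (?D \<rightarrow>\<^sub>E UNIV)"
      by (rule image_eqI)
  qed
  moreover have "finite (?D \<rightarrow>\<^sub>E (UNIV :: 'a set))"
    by (rule finite_PiE) simp_all
  ultimately show ?thesis
    using finite_surj by blast
qed

lemma carrier_mat_empty_dim:
  assumes "m = 0 \<or> n = 0"
  shows "carrier_mat m n = {0\<^sub>m m n :: 'a::zero mat}"
proof -
  have "X = 0\<^sub>m m n" if "X \<in> carrier_mat m n" for X :: "'a mat"
    by (rule eq_matI) (use assms that in auto)
  then show ?thesis by fastforce
qed

lemma rank_zero_mat: "vec_space.rank m (0\<^sub>m m n :: 'a::field mat) = 0"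
proof -
  interpret vec_space "TYPE('a)" m .
  let ?P = "\<lambda>T. T \<subseteq> set (cols (0\<^sub>m m n :: 'a mat)) \<and> lin_indpt T"
  have cols: "set (cols (0\<^sub>m m n :: 'a mat)) \<subseteq> {0\<^sub>v m}"
    by (auto simp: cols_def)
  have "T = {}" if "?P T" for T
  proof -
    have T: "T \<subseteq> {0\<^sub>v m}" and li: "lin_indpt T"
      using that cols by (blast, blast)
    have "0\<^sub>v m \<notin> T"
      using vs_zero_lin_dep[OF _ li] T by auto
    with T show ?thesis by blast
  qed
  moreover have "lin_indpt {}"
    by (rule finite_lin_indpt2) auto
  ultimately have "maximal {} ?P"
    unfolding maximal_def by simp
  then show ?thesis
    using rank_card_indpt[of "0\<^sub>m m n" n "{}"] by simp
qed

end

theory Submission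
  imports Defs
begin

text \<open>
  Let \<open>w\<close> be an integer weight on the field whose values sum to \<open>0\<close>; for \<open>w(0) = 1\<close>, \<open>w(1) = -1\<close> and
  \<open>w = 0\<close> elsewhere, the sum \<open>W(m,n,k)\<close> of \<open>w(X\<^bsub>11\<^esub> + \<dots> + X\<^bsub>kk\<^esub>) T^(rank X)\<close> over all
  \<open>m \<times> n\<close> matrices \<open>X\<close> is the polynomial \<open>g\<close>. Both sides of the theorem satisfy the same recursion
  in \<open>k\<close>: passing from \<open>(m,n,k)\<close> to \<open>(m+1,n+1,k+1)\<close> replaces \<open>T\<close> by \<open>qT\<close> and multiplies
  by \<open>1 - T\<close>. For the right side this is immediate from the product that defines the Pochhammer
  symbol. At \<open>k = 0\<close> both sides are \<open>A\<close>.

  For \<open>W\<close> (\<open>weighted_rank_poly_Suc\<close>) build a large matrix from a small one \<open>Y\<close> by putting a row \<open>u\<close>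
  on top, which gives a matrix \<open>Z\<close>, and then a column \<open>c\<close> in front. Fix \<open>Y\<close> and \<open>u\<close>. The partial trace
  of the result is \<open>c\<^bsub>0\<^esub> + t\<close>, where \<open>t\<close> is the partial trace of \<open>Y\<close>, and the rank is \<open>rank Z\<close> or
  \<open>rank Z + 1\<close> according as \<open>c\<close> lies in the column space of \<open>Z\<close> or not. Hence the sum over \<open>c\<close> is
  \<open>T^(rank Z + 1)\<close> times the sum of \<open>w(c\<^bsub>0\<^esub> + t)\<close> over all \<open>c\<close>, plus \<open>(1 - T) T^(rank Z)\<close> times
  the same sum over the column space.
  On a subspace that contains a vector with nonzero entry \<open>0\<close>, this entry is equidistributed, so the
  weights cancel (\<open>sum_weight_subspace\<close>). This kills the first sum, and the second one unless \<open>u = 0\<close>.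
  For \<open>u = 0\<close> the column space of \<open>Z\<close> is that of \<open>Y\<close> below a zero; it has \<open>q^(rank Y)\<close> elements
  and each contributes \<open>w(t)\<close>. What remains is \<open>(1 - T) (qT)^(rank Y) w(t)\<close>, summed over \<open>Y\<close>.

  Ranks are accessed only through the number \<open>q^rank\<close> of elements of the column space
  (\<open>card_mat_range\<close>).
\<close>

section \<open>Cardinality of the column space\<close>

definition mat_range :: "'a::field mat \<Rightarrow> 'a vec set" where
  "mat_range X = (*\<^sub>v) X ` carrier_vec (dim_col X)"

lemma mat_range_subset: "X \<in> carrier_mat m n \<Longrightarrow> mat_range X \<subseteq> carrier_vec m"
  by (auto simp: mat_range_def)

lemma mat_range_add:
  assumes X: "X \<in> carrier_mat m n" and "v \<in> mat_range X" "w \<in> mat_range X"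
  shows "v + w \<in> mat_range X"
proof -
  obtain a b where a: "a \<in> carrier_vec n" "v = X *\<^sub>v a" and b: "b \<in> carrier_vec n" "w = X *\<^sub>v b"
    using assms by (auto simp: mat_range_def)
  have "v + w = X *\<^sub>v (a + b)"
    using X a b by (simp add: mult_add_distrib_mat_vec)
  with X a b show ?thesis by (auto simp: mat_range_def)
qed

lemma mat_range_smult:
  assumes X: "X \<in> carrier_mat m n" and "v \<in> mat_range X"
  shows "l \<cdot>\<^sub>v v \<in> mat_range X"
proof -
  obtain a where a: "a \<in> carrier_vec n" "v = X *\<^sub>v a"
    using assms by (auto simp: mat_range_def)
  have "l \<cdot>\<^sub>v v = X *\<^sub>v (l \<cdot>\<^sub>v a)"
    using X a by (simp add: mult_mat_vec)
  with X a show ?thesis by (auto simp: mat_range_def)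
qed

lemma col_in_mat_range:
  assumes X: "X \<in> carrier_mat m n" and j: "j < n"
  shows "col X j \<in> mat_range X"
proof -
  have "X *\<^sub>v unit_vec n j = col X j"
    using X j by (intro eq_vecI) auto
  with X j show ?thesis unfolding mat_range_def by (intro image_eqI[where x="unit_vec n j"]) auto
qed

text \<open>
  The linear combinations of independent vectors are in bijection with the coefficient functions.
\<close>

lemma card_span_lin_indpt:
  fixes B :: "'a::{field,finite} vec set"
  assumes B: "B \<subseteq> carrier_vec n" "finite B"
    and li: "\<not> LinearCombinations.module.lin_dep class_ring (module_vec TYPE('a) n) B"
  shows "card (LinearCombinations.module.span class_ring (module_vec TYPE('a) n) B) = CARD('a) ^ card B"
proof -
  interpret vec_space "TYPE('a)" n .
  have "span B = {lincomb a B |a. a \<in> B \<rightarrow> (UNIV :: 'a set)}"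
    using finite_span[of B] B by (simp add: class_field_def)
  also have "\<dots> = (\<lambda>a. lincomb a B) ` (B \<rightarrow>\<^sub>E UNIV)"
  proof (intro equalityI subsetI)
    fix x assume "x \<in> {lincomb a B |a. a \<in> B \<rightarrow> (UNIV :: 'a set)}"
    then obtain a where x: "x = lincomb a B" by blast
    have "x = lincomb (restrict a B) B"
      unfolding x using B by (intro lincomb_cong) auto
    then show "x \<in> (\<lambda>a. lincomb a B) ` (B \<rightarrow>\<^sub>E UNIV)" by auto
  qed auto
  finally have span: "span B = (\<lambda>a. lincomb a B) ` (B \<rightarrow>\<^sub>E UNIV)" .
  have "inj_on (\<lambda>a. lincomb a B) (B \<rightarrow>\<^sub>E UNIV)"
  proof (rule inj_onI)
    fix a b :: "'a vec \<Rightarrow> 'a"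
    assume ab: "a \<in> B \<rightarrow>\<^sub>E UNIV" "b \<in> B \<rightarrow>\<^sub>E UNIV" and eq: "lincomb a B = lincomb b B"
    have "lincomb (\<lambda>x. a x - b x) B = 0\<^sub>v n"
    proof (rule eq_vecI)
      fix i assume "i < dim_vec (0\<^sub>v n :: 'a vec)"
      then have i: "i < n" by simp
      have "lincomb (\<lambda>x. a x - b x) B $ i = lincomb a B $ i - lincomb b B $ i"
        using lincomb_index[OF i B(1)] by (simp add: sum_subtractf left_diff_distrib)
      then show "lincomb (\<lambda>x. a x - b x) B $ i = 0\<^sub>v n $ i"
        using eq i by simp
    qed (use lincomb_dim[OF B(2,1)] in simp)
    then have "(\<lambda>x. a x - b x) \<in> B \<rightarrow> {0}"
      using not_lindepD[OF li B(2)] by (simp add: class_field_def)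
    then have "\<forall>x\<in>B. a x = b x" by auto
    then show "a = b" using ab by (metis PiE_ext)
  qed
  then have "card (span B) = card (B \<rightarrow>\<^sub>E (UNIV :: 'a set))"
    unfolding span by (rule card_image)
  then show ?thesis using B by (simp add: card_PiE)
qed

lemma card_field_ge_2: "CARD('a::{field,finite}) \<ge> 2"
proof -
  have "card {0, 1 :: 'a} \<le> CARD('a)" by (rule card_mono) auto
  then show ?thesis by simp
qed

text \<open>
  A maximal independent set of columns spans the column space and has as many elements as the rank;
  both claims concern this set, so they are proved together.
\<close>

lemma rank_props:
  fixes X :: "'a::{field,finite} mat"
  assumes X: "X \<in> carrier_mat m n"
  shows card_mat_range: "card (mat_range X) = CARD('a) ^ vec_space.rank m X"
    and rank_le_rows: "vec_space.rank m X \<le> m"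
proof -
  interpret vec_space "TYPE('a)" m .
  have cols: "set (cols X) \<subseteq> carrier_vec m" using cols_dim[of X] X by auto
  have "\<exists>S. finite S \<and> maximal S (\<lambda>T. T \<subseteq> set (cols X) \<and> lin_indpt T) \<and> {} \<subseteq> S"
    by (rule maximal_exists_superset[of "set (cols X)"]) (use finite_lin_indpt2[of "{}"] in auto)
  then obtain S where finS: "finite S"
    and max: "maximal S (\<lambda>T. T \<subseteq> set (cols X) \<and> lin_indpt T)"
    by blast
  then have S: "S \<subseteq> set (cols X)" "lin_indpt S" by (auto simp: maximal_def)
  then have Sc: "S \<subseteq> carrier_vec m" using cols by blast
  have rank: "rank X = card S" by (rule rank_card_indpt[OF X max])
  show "rank X \<le> m"
    using li_le_dim(2)[OF fin_dim, of S] Sc S(2) rank dim_is_n by simp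
  have "set (cols X) \<subseteq> span S"
  proof
    fix v assume v: "v \<in> set (cols X)"
    show "v \<in> span S"
    proof (rule ccontr)
      assume nin: "v \<notin> span S"
      then have "lin_indpt (S \<union> {v})"
        using lin_dep_iff_in_span[of S v] S Sc v cols span_mem[of S v] by auto
      then have "S \<union> {v} = S"
        using max S v unfolding maximal_def by blast
      then show False using nin span_mem[of S v] Sc by auto
    qed
  qed
  then have "span (set (cols X)) \<subseteq> span S"
    using span_is_subset[of "set (cols X)" "span S"] span_is_submodule[of S] Sc by simp
  moreover have "span S \<subseteq> span (set (cols X))"
    by (rule span_is_monotone[OF S(1)])
  ultimately have "mat_range X = span S"
    using col_space_eq[OF X] X unfolding col_space_def mat_range_def by auto
  then show "card (mat_range X) = CARD('a) ^ rank X"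
    using card_span_lin_indpt[OF Sc finS S(2)] rank by simp
qed

text \<open>
  Since \<open>q \<ge> 2\<close>, the cardinality of the column space determines the rank. This is how ranks of
  enlarged matrices are computed below.
\<close>

lemma rank_eqI_card:
  fixes X :: "'a::{field,finite} mat"
  assumes "X \<in> carrier_mat m n" and "card (mat_range X) = CARD('a) ^ r"
  shows "vec_space.rank m X = r"
  using card_mat_range[OF assms(1)] assms(2) card_field_ge_2[where 'a='a] by simp

section \<open>Adding a column and a row\<close>

definition add_col :: "'a vec \<Rightarrow> 'a mat \<Rightarrow> 'a mat" where
  "add_col c Z = mat (dim_row Z) (Suc (dim_col Z)) (\<lambda>(i, j). vCons (c $ i) (row Z i) $ j)"

definition add_row :: "'a vec \<Rightarrow> 'a mat \<Rightarrow> 'a mat" where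
  "add_row u Y = mat (Suc (dim_row Y)) (dim_col Y) (\<lambda>(i, j). vCons (u $ j) (col Y j) $ i)"

lemma add_col_carrier [simp]: "Z \<in> carrier_mat m n \<Longrightarrow> add_col c Z \<in> carrier_mat m (Suc n)"
  by (auto simp: add_col_def)

lemma add_row_carrier [simp]: "Y \<in> carrier_mat m n \<Longrightarrow> add_row u Y \<in> carrier_mat (Suc m) n"
  by (auto simp: add_row_def)

lemma dim_add_col [simp]:
  "dim_row (add_col c Z) = dim_row Z" "dim_col (add_col c Z) = Suc (dim_col Z)"
  by (simp_all add: add_col_def)

lemma dim_add_row [simp]:
  "dim_row (add_row u Y) = Suc (dim_row Y)" "dim_col (add_row u Y) = dim_col Y"
  by (simp_all add: add_row_def)

lemma sum_carrier_mat_add_col: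
  "(\<Sum>X\<in>carrier_mat m (Suc n). f X) = (\<Sum>Z\<in>carrier_mat m n. \<Sum>c\<in>carrier_vec m. f (add_col c Z))"
  unfolding sum.cartesian_product
  by (rule sum.reindex_bij_witness[where j="\<lambda>X. (mat m n (\<lambda>(i, j). X $$ (i, Suc j)), col X 0)"
        and i="\<lambda>(Z, c). add_col c Z"])
    (auto simp: add_col_def vec_index_vCons intro!: eq_matI eq_vecI arg_cong[of _ _ f])

lemma sum_carrier_mat_add_row:
  "(\<Sum>X\<in>carrier_mat (Suc m) n. f X) = (\<Sum>Y\<in>carrier_mat m n. \<Sum>u\<in>carrier_vec n. f (add_row u Y))"
  unfolding sum.cartesian_product
  by (rule sum.reindex_bij_witness[where j="\<lambda>X. (mat m n (\<lambda>(i, j). X $$ (Suc i, j)), row X 0)"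
        and i="\<lambda>(Y, u). add_row u Y"])
    (auto simp: add_row_def vec_index_vCons intro!: eq_matI eq_vecI arg_cong[of _ _ f])

lemma mat_range_add_col:
  assumes Z: "Z \<in> carrier_mat m n" and c: "c \<in> carrier_vec m"
  shows "mat_range (add_col c Z) = (\<lambda>(l, z). l \<cdot>\<^sub>v c + z) ` (UNIV \<times> mat_range Z)"
proof -
  have mult: "add_col c Z *\<^sub>v vCons l b = l \<cdot>\<^sub>v c + Z *\<^sub>v b" if b: "b \<in> carrier_vec n" for l b
  proof (rule eq_vecI)
    fix i assume "i < dim_vec (l \<cdot>\<^sub>v c + Z *\<^sub>v b)"
    then have i: "i < m" using Z c by simp
    have "row (add_col c Z) i = vCons (c $ i) (row Z i)"
      using Z i by (intro eq_vecI) (auto simp: add_col_def)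
    then show "(add_col c Z *\<^sub>v vCons l b) $ i = (l \<cdot>\<^sub>v c + Z *\<^sub>v b) $ i"
      using Z c i b by (simp add: index_mult_mat_vec)
  qed (use Z c in simp)
  have "carrier_vec (Suc n) = (\<lambda>(l, b). vCons l b) ` (UNIV \<times> (carrier_vec n :: 'a vec set))"
  proof (intro equalityI subsetI)
    fix v :: "'a vec" assume "v \<in> carrier_vec (Suc n)"
    then show "v \<in> (\<lambda>(l, b). vCons l b) ` (UNIV \<times> carrier_vec n)"
      by (cases v rule: vec_cases) auto
  qed auto
  moreover have "dim_col (add_col c Z) = Suc n" using Z by simp
  ultimately have "mat_range (add_col c Z)
      = (\<lambda>(l, b). add_col c Z *\<^sub>v vCons l b) ` (UNIV \<times> carrier_vec n)"
    by (auto simp: mat_range_def image_iff)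
  also have "\<dots> = (\<lambda>(l, b). l \<cdot>\<^sub>v c + Z *\<^sub>v b) ` (UNIV \<times> carrier_vec n)"
    by (rule image_cong) (auto simp: mult)
  also have "\<dots> = (\<lambda>(l, z). l \<cdot>\<^sub>v c + z) ` (UNIV \<times> mat_range Z)"
    using Z by (force simp: mat_range_def)
  finally show ?thesis .
qed

text \<open>
  If \<open>c\<close> is outside the column space \<open>S\<close> of \<open>Z\<close>, then \<open>(l, z) \<mapsto> l c + z\<close> is injective on
  \<open>F \<times> S\<close>, so the column space grows by the factor \<open>q\<close>.
\<close>

lemma rank_add_col:
  fixes Z :: "'a::{field,finite} mat"
  assumes Z: "Z \<in> carrier_mat m n" and c: "c \<in> carrier_vec m"
  shows "vec_space.rank m (add_col c Z)
    = (if c \<in> mat_range Z then vec_space.rank m Z else Suc (vec_space.rank m Z))"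
proof -
  let ?S = "mat_range Z"
  have Sc: "?S \<subseteq> carrier_vec m" by (rule mat_range_subset[OF Z])
  note add = mat_range_add[OF Z] and smult = mat_range_smult[OF Z]
  have "card (mat_range (add_col c Z)) =
    CARD('a) ^ (if c \<in> ?S then vec_space.rank m Z else Suc (vec_space.rank m Z))"
  proof (cases "c \<in> ?S")
    case True
    have "mat_range (add_col c Z) = ?S"
    proof (intro equalityI subsetI)
      fix z assume "z \<in> ?S"
      moreover from this have "z = 0 \<cdot>\<^sub>v c + z" using Sc c by (intro eq_vecI) auto
      ultimately show "z \<in> mat_range (add_col c Z)"
        unfolding mat_range_add_col[OF assms] by (intro image_eqI[where x="(0, z)"]) auto
    next
      fix z assume "z \<in> mat_range (add_col c Z)"
      then show "z \<in> ?S"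
        unfolding mat_range_add_col[OF assms] using add smult True by auto
    qed
    then show ?thesis using True card_mat_range[OF Z] by simp
  next
    case False
    have "inj_on (\<lambda>(l, z). l \<cdot>\<^sub>v c + z) (UNIV \<times> ?S)"
    proof (rule inj_onI, clarify)
      fix l l' z z'
      assume z: "z \<in> ?S" "z' \<in> ?S" and eq: "l \<cdot>\<^sub>v c + z = l' \<cdot>\<^sub>v c + z'"
      have zc: "z \<in> carrier_vec m" "z' \<in> carrier_vec m" using z Sc by auto
      have pt: "l * c $ i + z $ i = l' * c $ i + z' $ i" if "i < m" for i
        using arg_cong[OF eq, of "\<lambda>v. v $ i"] zc c that by simp
      have "l = l'"
      proof (rule ccontr)
        assume ne: "l \<noteq> l'"
        \<comment> \<open>Otherwise the equation can be solved for \<open>c\<close>, which places \<open>c\<close> in \<open>S\<close>.\<close>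
        have "c = inverse (l - l') \<cdot>\<^sub>v (z' + (-1) \<cdot>\<^sub>v z)"
        proof (rule eq_vecI)
          fix i assume "i < dim_vec (inverse (l - l') \<cdot>\<^sub>v (z' + (-1) \<cdot>\<^sub>v z))"
          then have i: "i < m" using zc by simp
          have "(l - l') * c $ i = z' $ i - z $ i"
            using pt[OF i] by (simp add: algebra_simps)
          then have "c $ i = inverse (l - l') * (z' $ i - z $ i)"
            using ne by (simp add: field_simps)
          then show "c $ i = (inverse (l - l') \<cdot>\<^sub>v (z' + (-1) \<cdot>\<^sub>v z)) $ i"
            using zc i by simp
        qed (use zc c in simp)
        then show False using False z add smult by metis
      qed
      moreover from this have "z = z'"
        using pt zc by (intro eq_vecI) auto
      ultimately show "l = l' \<and> z = z'" by simp
    qed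
    then have "card (mat_range (add_col c Z)) = card (UNIV \<times> ?S :: ('a \<times> 'a vec) set)"
      unfolding mat_range_add_col[OF assms] by (rule card_image)
    then show ?thesis using False card_mat_range[OF Z] by (simp add: card_cartesian_product)
  qed
  then show ?thesis by (rule rank_eqI_card[OF add_col_carrier[OF Z]])
qed

lemma mat_range_add_row_zero:
  assumes Y: "Y \<in> carrier_mat m n"
  shows "mat_range (add_row (0\<^sub>v n) Y) = vCons 0 ` mat_range Y"
proof -
  have "add_row (0\<^sub>v n) Y *\<^sub>v b = vCons 0 (Y *\<^sub>v b)" if b: "b \<in> carrier_vec n" for b
  proof (rule eq_vecI)
    fix i assume "i < dim_vec (vCons 0 (Y *\<^sub>v b))"
    then have i: "i < Suc m" using Y by simp
    have "row (add_row (0\<^sub>v n) Y) i = (case i of 0 \<Rightarrow> 0\<^sub>v n | Suc i' \<Rightarrow> row Y i')"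
      using Y i by (intro eq_vecI) (auto simp: add_row_def split: nat.split)
    then show "(add_row (0\<^sub>v n) Y *\<^sub>v b) $ i = vCons 0 (Y *\<^sub>v b) $ i"
      using Y i b by (auto split: nat.split simp: vec_index_vCons)
  qed (use Y in simp)
  moreover have "dim_col (add_row (0\<^sub>v n) Y) = n" using Y by simp
  ultimately show ?thesis using Y by (force simp: mat_range_def)
qed

lemma rank_add_row_zero:
  fixes Y :: "'a::{field,finite} mat"
  assumes Y: "Y \<in> carrier_mat m n"
  shows "vec_space.rank (Suc m) (add_row (0\<^sub>v n) Y) = vec_space.rank m Y"
proof (rule rank_eqI_card[OF add_row_carrier[OF Y]])
  have "inj_on (vCons 0) (mat_range Y)" by (rule inj_onI) simp
  then show "card (mat_range (add_row (0\<^sub>v n) Y)) = CARD('a) ^ vec_space.rank m Y"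
    unfolding mat_range_add_row_zero[OF Y] using card_mat_range[OF Y] by (simp add: card_image)
qed

section \<open>Removing the first row and the first column\<close>

lemma finite_carrier_vec [simp]: "finite (carrier_vec m :: 'a::finite vec set)"
proof -
  have "carrier_vec m \<subseteq> (\<lambda>X. col X 0) ` (carrier_mat m 1 :: 'a mat set)"
  proof
    fix v :: "'a vec" assume v: "v \<in> carrier_vec m"
    then have "v = col (mat m 1 (\<lambda>(i, j). v $ i)) 0" by (intro eq_vecI) auto
    then show "v \<in> (\<lambda>X. col X 0) ` carrier_mat m 1" by (rule image_eqI) simp
  qed
  then show ?thesis by (rule finite_subset) (simp add: finite_carrier_mat)
qed

text \<open>
  Translation by a multiple of \<open>d\<close> permutes \<open>S\<close> and shifts entry \<open>i\<close> by any prescribed amount.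
  So the sum equals its average over all shifts, and there each summand runs through all values of
  the weight.
\<close>

lemma sum_weight_subspace:
  fixes w :: "'a::{field,finite} \<Rightarrow> int"
  assumes w: "sum w UNIV = 0" and S: "S \<subseteq> carrier_vec m"
    and add: "\<And>v v'. v \<in> S \<Longrightarrow> v' \<in> S \<Longrightarrow> v + v' \<in> S"
    and smult: "\<And>l v. v \<in> S \<Longrightarrow> l \<cdot>\<^sub>v v \<in> S"
    and d: "d \<in> S" "d $ i \<noteq> 0" and i: "i < m"
  shows "(\<Sum>c\<in>S. w (c $ i + t)) = 0"
proof -
  have shift: "(\<Sum>c\<in>S. w (c $ i + t)) = (\<Sum>c\<in>S. w (c $ i + t + l))" for l
  proof -
    let ?d = "(l / d $ i) \<cdot>\<^sub>v d" and ?d' = "(- l / d $ i) \<cdot>\<^sub>v d"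
    have dim: "dim_vec v = m" if "v \<in> S" for v using S that by auto
    show ?thesis
    proof (rule sum.reindex_bij_witness[where j="\<lambda>v. v + ?d'" and i="\<lambda>v. v + ?d"])
      fix v assume v: "v \<in> S"
      show "v + ?d' + ?d = v" and "v + ?d + ?d' = v"
        using dim[OF v] dim[OF d(1)] by (auto intro!: eq_vecI)
      show "v + ?d' \<in> S" and "v + ?d \<in> S" using add smult v d by auto
      show "w ((v + ?d') $ i + t + l) = w (v $ i + t)"
        using dim[OF v] dim[OF d(1)] d(2) i by (simp add: algebra_simps)
    qed
  qed
  have "int CARD('a) * (\<Sum>c\<in>S. w (c $ i + t)) = (\<Sum>l::'a\<in>UNIV. \<Sum>c\<in>S. w (c $ i + t))"
    by simp
  also have "\<dots> = (\<Sum>l\<in>UNIV. \<Sum>c\<in>S. w (c $ i + t + l))"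
    by (intro sum.cong refl shift)
  also have "\<dots> = (\<Sum>c\<in>S. \<Sum>l\<in>UNIV. w (c $ i + t + l))" by (rule sum.swap)
  also have "\<dots> = (\<Sum>c\<in>S. sum w UNIV)"
  proof (rule sum.cong[OF refl])
    fix c
    show "(\<Sum>l\<in>UNIV. w (c $ i + t + l)) = sum w UNIV"
      by (rule sum.reindex_bij_witness[where j="\<lambda>l. c $ i + t + l" and i="\<lambda>l. l - (c $ i + t)"]) auto
  qed
  finally show ?thesis using w by simp
qed

text \<open>
  The contribution of all matrices with given lower right block \<open>Y\<close> and given rest \<open>u\<close> of the first
  row. The polynomial variable records the rank, and \<open>[:1, -1:]\<close> is \<open>1 - T\<close>.
\<close>

lemma sum_weight_add_col:
  fixes w :: "'a::{field,finite} \<Rightarrow> int"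
  assumes w: "sum w UNIV = 0" and Y: "Y \<in> carrier_mat m n" and u: "u \<in> carrier_vec n"
  defines "r \<equiv> vec_space.rank m Y"
  shows "(\<Sum>c\<in>carrier_vec (Suc m). monom (w (c $ 0 + t)) (vec_space.rank (Suc m) (add_col c (add_row u Y))))
    = (if u = 0\<^sub>v n then [:1, -1:] * monom (w t * int CARD('a) ^ r) r else 0)"
proof -
  let ?Z = "add_row u Y"
  let ?S = "mat_range ?Z" and ?r = "vec_space.rank (Suc m) ?Z"
  have Z: "?Z \<in> carrier_mat (Suc m) n" using Y by simp
  have Sc: "?S \<subseteq> carrier_vec (Suc m)" by (rule mat_range_subset[OF Z])
  have all: "(\<Sum>c\<in>carrier_vec (Suc m). w (c $ 0 + t)) = 0"
    by (rule sum_weight_subspace[OF w subset_refl, where d="unit_vec (Suc m) 0"]) auto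
  \<comment> \<open>The generic rank \<open>?r + 1\<close> is corrected on the column space, because \<open>T^r = T^(r+1) + (1 - T) T^r\<close>.\<close>
  have "(\<Sum>c\<in>carrier_vec (Suc m). monom (w (c $ 0 + t)) (vec_space.rank (Suc m) (add_col c ?Z)))
    = (\<Sum>c\<in>carrier_vec (Suc m). monom (w (c $ 0 + t)) (Suc ?r)
        + (if c \<in> ?S then [:1, -1:] * monom (w (c $ 0 + t)) ?r else 0))"
    by (rule sum.cong[OF refl]) (simp add: rank_add_col[OF Z] monom_Suc add_monom)
  also have "\<dots> = monom (\<Sum>c\<in>carrier_vec (Suc m). w (c $ 0 + t)) (Suc ?r)
      + (\<Sum>c\<in>?S. [:1, -1:] * monom (w (c $ 0 + t)) ?r)"
    using Sc by (simp add: sum.distrib monom_sum sum.inter_restrict[symmetric] Int_absorb1)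
  also have "\<dots> = [:1, -1:] * monom (\<Sum>c\<in>?S. w (c $ 0 + t)) ?r"
    by (simp only: all sum_distrib_left monom_sum) simp
  also have "\<dots> = (if u = 0\<^sub>v n then [:1, -1:] * monom (w t * int CARD('a) ^ r) r else 0)"
  proof (cases "u = 0\<^sub>v n")
    case True
    have r: "?r = r" unfolding True r_def by (rule rank_add_row_zero[OF Y])
    have "c $ 0 = 0" if "c \<in> ?S" for c
      using that unfolding True mat_range_add_row_zero[OF Y] by auto
    then have "(\<Sum>c\<in>?S. w (c $ 0 + t)) = (\<Sum>c\<in>?S. w t)"
      by (intro sum.cong) auto
    then show ?thesis using True card_mat_range[OF Z] r by (simp add: mult.commute)
  next
    case False
    then obtain j where j: "j < n" "u $ j \<noteq> 0" using u by (auto simp: vec_eq_iff)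
    have "(\<Sum>c\<in>?S. w (c $ 0 + t)) = 0"
    proof (rule sum_weight_subspace[OF w Sc mat_range_add[OF Z] mat_range_smult[OF Z]])
      show "col ?Z j \<in> ?S" by (rule col_in_mat_range[OF Z j(1)])
      show "col ?Z j $ 0 \<noteq> 0" using Y j by (simp add: add_row_def)
    qed auto
    then show ?thesis using False by simp
  qed
  finally show ?thesis .
qed

definition weighted_rank_poly :: "('a::{field,finite} \<Rightarrow> int) \<Rightarrow> nat \<Rightarrow> nat \<Rightarrow> nat \<Rightarrow> int poly" where
  "weighted_rank_poly w m n k =
    (\<Sum>X\<in>carrier_mat m n. monom (w (\<Sum>i<k. X $$ (i, i))) (vec_space.rank m X))"

lemma pcompose_monom_scale:
  "pcompose (monom a r) [:0, c:] = monom (a * c ^ r) (r::nat)" for a c :: "'b::comm_ring_1"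
  by (induction r) (simp_all add: monom_0 monom_Suc pcompose_pCons smult_monom ac_simps)

text \<open>
  Only \<open>u = 0\<close> contributes. The factor \<open>q^r\<close> that accompanies a block \<open>Y\<close> of rank \<open>r\<close> is absorbed
  by the substitution \<open>T \<mapsto> qT\<close>.
\<close>

lemma weighted_rank_poly_Suc:
  fixes w :: "'a::{field,finite} \<Rightarrow> int"
  assumes w: "sum w UNIV = 0" and k: "k \<le> m" "k \<le> n"
  shows "weighted_rank_poly w (Suc m) (Suc n) (Suc k)
    = [:1, -1:] * pcompose (weighted_rank_poly w m n k) [:0, int CARD('a):]"
proof -
  have trace: "(\<Sum>i<Suc k. add_col c (add_row u Y) $$ (i, i)) = c $ 0 + (\<Sum>i<k. Y $$ (i, i))"
    if "Y \<in> carrier_mat m n" for c u and Y :: "'a mat"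
    unfolding sum.lessThan_Suc_shift using that k
    by (intro arg_cong2[of _ _ _ _ "(+)"] sum.cong) (auto simp: add_col_def add_row_def)
  have "weighted_rank_poly w (Suc m) (Suc n) (Suc k) =
    (\<Sum>Y\<in>carrier_mat m n. \<Sum>u\<in>carrier_vec n. \<Sum>c\<in>carrier_vec (Suc m).
       monom (w (c $ 0 + (\<Sum>i<k. Y $$ (i, i)))) (vec_space.rank (Suc m) (add_col c (add_row u Y))))"
    unfolding weighted_rank_poly_def sum_carrier_mat_add_col sum_carrier_mat_add_row
    by (intro sum.cong refl) (simp only: trace)
  also have "\<dots> = (\<Sum>Y\<in>carrier_mat m n. \<Sum>u\<in>carrier_vec n. if u = (0\<^sub>v n :: 'a vec) then
      [:1, -1:] * monom (w (\<Sum>i<k. Y $$ (i, i)) * int CARD('a) ^ vec_space.rank m Y) (vec_space.rank m Y)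
      else 0)"
    by (intro sum.cong refl sum_weight_add_col[OF w])
  also have "\<dots> = (\<Sum>Y\<in>carrier_mat m n.
      [:1, -1:] * monom (w (\<Sum>i<k. Y $$ (i, i)) * int CARD('a) ^ vec_space.rank m Y) (vec_space.rank m Y))"
    by (simp only: sum.delta finite_carrier_vec zero_carrier_vec if_True)
  also have "\<dots> = [:1, -1:] * pcompose (weighted_rank_poly w m n k) [:0, int CARD('a):]"
    unfolding weighted_rank_poly_def pcompose_sum pcompose_monom_scale sum_distrib_left ..
  finally show ?thesis .
qed

section \<open>The product formula\<close>

lemma sum_monom_rank_mats:
  fixes v :: "'a::{field,finite} mat \<Rightarrow> int"
  shows "(\<Sum>X\<in>carrier_mat m n. monom (v X) (vec_space.rank m X))
    = (\<Sum>r=0..m. monom (\<Sum>X\<in>rank_mats m n r. v X) r)"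
proof -
  have "(\<Sum>X\<in>carrier_mat m n. monom (v X) (vec_space.rank m X))
    = (\<Sum>r=0..m. \<Sum>X | X \<in> carrier_mat m n \<and> vec_space.rank m X = r. monom (v X) (vec_space.rank m X))"
    by (rule sum.group[symmetric]) (auto simp: finite_carrier_mat intro: rank_le_rows)
  also have "\<dots> = (\<Sum>r=0..m. monom (\<Sum>X\<in>rank_mats m n r. v X) r)"
    by (simp add: monom_sum rank_mats_def)
  finally show ?thesis .
qed

lemma weighted_rank_poly_0:
  fixes w :: "'a::{field,finite} \<Rightarrow> int"
  shows "weighted_rank_poly w m n 0 = [:w 0:] * (A_poly TYPE('a) m n)"
  unfolding weighted_rank_poly_def sum_monom_rank_mats A_poly_def a_count_def sum_distrib_left
  by (simp add: smult_monom mult.commute)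

lemma g_poly_eq_weighted_rank_poly:
  "g_poly TYPE('a::{field,finite}) m n k
    = weighted_rank_poly (\<lambda>\<alpha>::'a. of_bool (\<alpha> = 0) - of_bool (\<alpha> = 1)) m n k"
proof -
  have fin: "finite (rank_mats m n r :: 'a mat set)" for r
    by (rule finite_subset[OF _ finite_carrier_mat[of m n]]) (auto simp: rank_mats_def)
  have "g_coeff TYPE('a) m n r k
    = (\<Sum>X\<in>rank_mats m n r. of_bool ((\<Sum>i<k. X $$ (i, i)) = (0::'a)) - of_bool ((\<Sum>i<k. X $$ (i, i)) = 1))"
    for r
    unfolding g_coeff_def f_count_def sum_subtractf using fin[of r]
    by (simp add: of_bool_def sum.If_cases Int_def)
  then show ?thesis
    unfolding g_poly_def weighted_rank_poly_def sum_monom_rank_mats by simp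
qed

text \<open>
  The factor split off is the one with index \<open>0\<close>; the substitution shifts the index of the others,
  in step with the recursion for the weighted sums.
\<close>

lemma q_pochhammer_Suc:
  "q_pochhammer [:0, 1:] (of_nat q) (Suc k)
    = [:1, -1:] * pcompose (q_pochhammer [:0, 1:] (of_nat q) k) [:0, int q:]"
proof -
  have [simp]: "of_nat q = [:int q:]" by (simp add: of_nat_poly)
  have "pcompose (1 - [:0, 1:] * of_nat q ^ i) [:0, int q:] = 1 - [:0, 1:] * of_nat q ^ Suc i" for i
    by (simp add: pcompose_diff pcompose_mult pcompose_pCons poly_const_pow pcompose_1 del: of_nat_poly)
  then show ?thesis
    unfolding q_pochhammer_def prod.lessThan_Suc_shift pcompose_prod
    by (simp add: one_pCons)
qed

lemma weighted_rank_poly_eq: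
  fixes w :: "'a::{field,finite} \<Rightarrow> int"
  assumes "sum w UNIV = 0" and "k \<le> m" "k \<le> n"
  shows "weighted_rank_poly w m n k = [:w 0:] * (q_pochhammer [:0, 1:] (of_nat CARD('a)) k *
    pcompose (A_poly TYPE('a) (m - k) (n - k)) [:0, int CARD('a) ^ k:])"
  using assms(2,3)
proof (induction k arbitrary: m n)
  case 0
  show ?case by (simp add: weighted_rank_poly_0 q_pochhammer_def)
next
  case (Suc k)
  then obtain m' n' where mn: "m = Suc m'" "n = Suc n'" and le: "k \<le> m'" "k \<le> n'"
    by (metis Suc_le_D Suc_le_mono)
  have "pcompose [:0, int CARD('a) ^ k:] [:0, int CARD('a):] = [:0, int CARD('a) ^ Suc k:]"
    by (simp add: pcompose_pCons mult.commute)
  then show ?case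
    unfolding mn weighted_rank_poly_Suc[OF assms(1) le] Suc.IH[OF le] q_pochhammer_Suc
    by (simp add: pcompose_mult pcompose_assoc[symmetric] mult_ac
      del: mult_pCons_left)
qed

theorem theorem4p1:
  fixes k m n q :: nat
  assumes "CARD('a::{field,finite}) = q"
    and "k \<le> m" and "m \<le> n"
  shows "g_poly TYPE('a) m n k =
    q_pochhammer [:0, 1:] (of_nat q) k * pcompose (A_poly TYPE('a) (m - k) (n - k)) [:0, int q ^ k:]"
proof -
  have "(\<Sum>\<alpha>::'a\<in>UNIV. of_bool (\<alpha> = 0) - of_bool (\<alpha> = 1) :: int) = 0"
    by (simp add: sum_subtractf of_bool_def)
  from weighted_rank_poly_eq[OF this, of k m n] show ?thesis
    using assms by (simp add: g_poly_eq_weighted_rank_poly)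
qed

end
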